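(* Suppose the reference set $\mathcal P\subset\mathbb R^N$ is a full-dimensional polyhedral set described by $\mathcal P=\{\mathbf r\in\mathbb R^N \mid S\mathbf r\le h\}$, with $S\in\mathbb R^{n_h\times N}$ and $h\in\mathbb R^{n_h}$. Then for the given initial state $x_0\in\mathbb R^{n_x}$, $$\mathcal F(x_0)=\left\{(\mathbf M,\mathbf v)\;\middle|\;\begin{aligned}&\exists\,\mathbf Z\in\mathbb R^{n_h\times n_c},\ \mathbf Z\ge 0,\ \text{such that}\\ &\Sigma\mathbf v+\mathbf Z^Th\le\sigma+\Xi x_0,\\ &\mathbf Z^TS=\Sigma\mathbf M,\\ &\Gamma\mathbf M=\mathcal I_N,\quad \Gamma\mathbf v=0,\\ &\mathbf M\in\mathcal{LT}\end{aligned}\right\}.$$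
   Context: System and constraints: consider the discrete-time linear system $x_{i+1}=Ax_i+Bu_i$ with $x_i\in\mathbb R^{n_x}$, $u_i\in\mathbb R^{n_u}$, polytopic state-input constraints $Fx_i+Gu_i\le c$, and a polytopic terminal constraint $x_N\in\mathbb X_f=\{x\mid Hx\le p\}$, over a fixed horizon $N$. Write $\mathbf u=(u_0^T,\dots,u_{N-1}^T)^T$ and $\mathbf x=(x_0^T,\dots,x_N^T)^T$. In condensed form the dynamics and constraints are $\mathbf x=\mathbf A x_0+\mathbf B\mathbf u$ and $\mathbf F\mathbf x+\mathbf G\mathbf u\le\mathbf c$, where $\mathbf A,\mathbf B$ stack the dynamics and $\mathbf F,\mathbf G,\mathbf c$ stack the stage constraints for $i=0,\dots,N-1$ and the terminal constraint; $n_c$ is the number of rows of $\mathbf F$. Set $\Sigma:=\mathbf F\mathbf B+\mathbf G$, $\sigma:=\mathbf c$, $\Xi:=-\mathbf F\mathbf A$. Tracking: the reference $\mathbf r=(r_0,\dots,r_{N-1})\in\mathbb R^N$ must be tracked through $g^Tu_i=r_i$ for a given vector $g\in\mathbb R^{n_u}$. Set $\Gamma:=\mathcal I_N\otimes g^T\in\mathbb R^{N\times Nn_u}$, where $\mathcal I_N$ is the $N\times N$ identity and $\otimes$ the Kronecker product. Policies: affine policies are $\mathbf u=\mathbf M\mathbf r+\mathbf v$ with $\mathbf M\in\mathbb R^{Nn_u\times N}$, $\mathbf v\in\mathbb R^{Nn_u}$. The notation $\mathbf M\in\mathcal{LT}$ means that $\mathbf M$ is block lower triangular, with blocks $M_{i,j}\in\mathbb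 R^{n_u\times 1}$, $i,j\in\{0,\dots,N-1\}$, and $M_{i,j}=0$ for $j>i$ (so $u_i=\sum_{j=0}^iM_{i,j}r_j+v_i$). For a reference set $\mathcal P\subset\mathbb R^N$ and an initial state $x_0$, the set of admissible affine policies is $$\mathcal F(x_0)=\{(\mathbf M,\mathbf v)\mid \mathbf M\in\mathcal{LT},\ \text{and}\ \forall\mathbf r\in\mathcal P:\ \Sigma(\mathbf M\mathbf r+\mathbf v)\le\sigma+\Xi x_0,\ \Gamma(\mathbf M\mathbf r+\mathbf v)=\mathbf r\}.$$ All vector and matrix inequalities are componentwise. *)

theory Defs
  imports "Jordan_Normal_Form.VS_Connect"
begin

definition kronecker :: "real mat \<Rightarrow> real mat \<Rightarrow> real mat" where
  "kronecker X Y = mat (dim_row X * dim_row Y) (dim_col X * dim_col Y)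
     (\<lambda>(i, j). X $$ (i div dim_row Y, j div dim_col Y) * Y $$ (i mod dim_row Y, j mod dim_col Y))"

text \<open>The condensed form of the dynamics and constraints over the horizon \<open>N\<close>.  Blocks are
  numbered from 0, so \<open>stack_A\<close> and \<open>stack_B\<close> have \<open>N + 1\<close> block rows (for the states
  \<open>x\<^sub>0, \<dots>, x\<^sub>N\<close>).  In \<open>stack_F\<close> and \<open>stack_G\<close> the \<open>N\<close> stage constraints come first and the
  terminal constraint, which does not involve the input, comes last.\<close>

definition stack_A :: "nat \<Rightarrow> real mat \<Rightarrow> real mat" where
  "stack_A N A = (let nx = dim_row A in
     mat (Suc N * nx) nx (\<lambda>(k, l). (A ^\<^sub>m (k div nx)) $$ (k mod nx, l)))"

definition stack_B :: "nat \<Rightarrow> real mat \<Rightarrow> real mat \<Rightarrow> real mat" where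
  "stack_B N A B = (let nx = dim_row B; nu = dim_col B in
     mat (Suc N * nx) (N * nu) (\<lambda>(k, l).
       let i = k div nx; j = l div nu in
       if j < i then (A ^\<^sub>m (i - 1 - j) * B) $$ (k mod nx, l mod nu) else 0))"

definition stack_F :: "nat \<Rightarrow> real mat \<Rightarrow> real mat \<Rightarrow> real mat" where
  "stack_F N F H = four_block_mat
     (kronecker (1\<^sub>m N) F) (0\<^sub>m (N * dim_row F) (dim_col H))
     (0\<^sub>m (dim_row H) (N * dim_col F)) H"

definition stack_G :: "nat \<Rightarrow> real mat \<Rightarrow> real mat \<Rightarrow> real mat" where
  "stack_G N G H = kronecker (1\<^sub>m N) G @\<^sub>r 0\<^sub>m (dim_row H) (N * dim_col G)"

definition stack_c :: "nat \<Rightarrow> real vec \<Rightarrow> real vec \<Rightarrow> real vec" where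
  "stack_c N c p = vec (N * dim_vec c) (\<lambda>i. c $ (i mod dim_vec c)) @\<^sub>v p"

definition block :: "nat \<Rightarrow> nat \<Rightarrow> real vec \<Rightarrow> real vec" where
  "block n i w = vec n (\<lambda>k. w $ (i * n + k))"

fun trajectory :: "real mat \<Rightarrow> real mat \<Rightarrow> real vec \<Rightarrow> real vec \<Rightarrow> nat \<Rightarrow> real vec" where
  "trajectory A B x0 u 0 = x0"
| "trajectory A B x0 u (Suc i) =
     A *\<^sub>v trajectory A B x0 u i + B *\<^sub>v block (dim_col B) i u"

lemma block_index_less: "i < N \<Longrightarrow> k < n \<Longrightarrow> i * n + k < N * (n::nat)"
proof -
  assume "i < N" "k < n"
  then have "i * n + k < Suc i * n" "Suc i * n \<le> N * n"
    by (simp, intro mult_le_mono1, simp)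
  then show ?thesis by linarith
qed

lemma sum_blocks:
  fixes f :: "nat \<Rightarrow> real"
  shows "(\<Sum>l = 0..<N * n. f l) = (\<Sum>j = 0..<N. \<Sum>k = 0..<n. f (j * n + k))"
proof -
  have "(\<Sum>l = 0..<N * n. f l) = (\<Sum>j<N. sum f {j * n..<j * n + n})"
    by (simp only: sum.nat_group flip: lessThan_atLeast0)
  also have "\<dots> = (\<Sum>j = 0..<N. \<Sum>k = 0..<n. f (j * n + k))"
    unfolding lessThan_atLeast0
  proof (rule sum.cong)
    fix j
    show "sum f {j * n..<j * n + n} = (\<Sum>k = 0..<n. f (j * n + k))"
      using sum.shift_bounds_nat_ivl[of f 0 "j * n" n] by (simp add: add.commute)
  qed auto
  finally show ?thesis .
qed

lemma mult_mat_vec_index: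
  fixes M :: "real mat"
  assumes "M \<in> carrier_mat a b" "v \<in> carrier_vec b" "i < a"
  shows "(M *\<^sub>v v) $ i = (\<Sum>l = 0..<b. M $$ (i, l) * v $ l)"
  using assms by (auto simp: scalar_prod_def intro!: sum.cong)

lemma kronecker_one_mult_vec:
  assumes X: "X \<in> carrier_mat a b" and w: "w \<in> carrier_vec (N * b)" and i: "i < N" and k: "k < a"
  shows "(kronecker (1\<^sub>m N) X *\<^sub>v w) $ (i * a + k) = (X *\<^sub>v block b i w) $ k"
proof -
  have K: "kronecker (1\<^sub>m N) X \<in> carrier_mat (N * a) (N * b)"
    using X by (auto simp: kronecker_def)
  have ik: "i * a + k < N * a" using block_index_less[OF i k] .
  have "(kronecker (1\<^sub>m N) X *\<^sub>v w) $ (i * a + k)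
      = (\<Sum>j = 0..<N. \<Sum>l = 0..<b. kronecker (1\<^sub>m N) X $$ (i * a + k, j * b + l) * w $ (j * b + l))"
    using mult_mat_vec_index[OF K w ik] by (simp add: sum_blocks)
  also have "\<dots> = (\<Sum>j = 0..<N. if j = i then \<Sum>l = 0..<b. X $$ (k, l) * w $ (i * b + l) else 0)"
  proof (rule sum.cong[OF refl])
    fix j assume j: "j \<in> {0..<N}"
    have e: "kronecker (1\<^sub>m N) X $$ (i * a + k, j * b + l) = (if j = i then X $$ (k, l) else 0)"
      if l: "l < b" for l
    proof -
      have "j * b + l < N * b" using block_index_less[of j N l b] j l by simp
      then show ?thesis using X ik k l i j by (auto simp: kronecker_def)
    qed
    show "(\<Sum>l = 0..<b. kronecker (1\<^sub>m N) X $$ (i * a + k, j * b + l) * w $ (j * b + l))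
        = (if j = i then \<Sum>l = 0..<b. X $$ (k, l) * w $ (i * b + l) else 0)"
      by (simp add: e)
  qed
  also have "\<dots> = (\<Sum>l = 0..<b. X $$ (k, l) * w $ (i * b + l))" using i by simp
  also have "\<dots> = (X *\<^sub>v block b i w) $ k"
    using mult_mat_vec_index[OF X _ k, of "block b i w"] by (simp add: block_def)
  finally show ?thesis .
qed

lemma pow_mat_Suc_left:
  assumes A: "(A :: real mat) \<in> carrier_mat n n"
  shows "A ^\<^sub>m Suc k = A * A ^\<^sub>m k"
proof (induction k)
  case (Suc k)
  have "A ^\<^sub>m Suc (Suc k) = (A * A ^\<^sub>m k) * A" using Suc by simp
  also have "\<dots> = A * (A ^\<^sub>m k * A)" using A by (simp add: assoc_mult_mat[of _ n n _ n _ n])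
  finally show ?case by simp
qed (use A in simp)

lemma stack_AB_index:
  assumes A: "A \<in> carrier_mat nx nx" and B: "B \<in> carrier_mat nx nu"
    and x0: "x0 \<in> carrier_vec nx" and u: "u \<in> carrier_vec (N * nu)" and i: "i \<le> N" and k: "k < nx"
  shows "(stack_A N A *\<^sub>v x0 + stack_B N A B *\<^sub>v u) $ (i * nx + k)
    = (A ^\<^sub>m i *\<^sub>v x0) $ k + (\<Sum>j = 0..<i. ((A ^\<^sub>m (i - 1 - j) * B) *\<^sub>v block nu j u) $ k)"
proof -
  have SA: "stack_A N A \<in> carrier_mat (Suc N * nx) nx" using A by (auto simp: stack_A_def Let_def)
  have SB: "stack_B N A B \<in> carrier_mat (Suc N * nx) (N * nu)"
    using A B by (auto simp: stack_B_def Let_def)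
  have ik: "i * nx + k < Suc N * nx" using block_index_less[of i "Suc N" k nx] i k by simp
  have P: "A ^\<^sub>m e \<in> carrier_mat nx nx" for e using A by simp
  have PB: "A ^\<^sub>m e * B \<in> carrier_mat nx nu" for e using P B by (rule mult_carrier_mat)
  have a: "(stack_A N A *\<^sub>v x0) $ (i * nx + k) = (A ^\<^sub>m i *\<^sub>v x0) $ k"
  proof -
    have "stack_A N A $$ (i * nx + k, l) = (A ^\<^sub>m i) $$ (k, l)" if "l < nx" for l
      using A that ik k unfolding stack_A_def Let_def by (subst index_mat) auto
    then show ?thesis
      unfolding mult_mat_vec_index[OF SA x0 ik] mult_mat_vec_index[OF P x0 k] by simp
  qed
  have "(stack_B N A B *\<^sub>v u) $ (i * nx + k)
     = (\<Sum>j = 0..<N. \<Sum>l = 0..<nu. stack_B N A B $$ (i * nx + k, j * nu + l) * u $ (j * nu + l))"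
    using mult_mat_vec_index[OF SB u ik] by (simp add: sum_blocks)
  also have "\<dots> = (\<Sum>j = 0..<N. if j < i
      then ((A ^\<^sub>m (i - 1 - j) * B) *\<^sub>v block nu j u) $ k else 0)"
  proof (rule sum.cong[OF refl])
    fix j assume j: "j \<in> {0..<N}"
    have e: "stack_B N A B $$ (i * nx + k, j * nu + l)
        = (if j < i then (A ^\<^sub>m (i - 1 - j) * B) $$ (k, l) else 0)" if l: "l < nu" for l
    proof -
      have jl: "j * nu + l < N * nu" using block_index_less[of j N l nu] j l by simp
      have d: "dim_row B = nx" "dim_col B = nu" using B by auto
      have dm: "(i * nx + k) div nx = i" "(i * nx + k) mod nx = k"
        "(j * nu + l) div nu = j" "(j * nu + l) mod nu = l" using k l by auto
      show ?thesis
        unfolding stack_B_def Let_def d index_mat(1)[OF ik jl] split dm ..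
    qed
    have r: "((A ^\<^sub>m (i - 1 - j) * B) *\<^sub>v block nu j u) $ k
        = (\<Sum>l = 0..<nu. (A ^\<^sub>m (i - 1 - j) * B) $$ (k, l) * u $ (j * nu + l))"
      using mult_mat_vec_index[OF PB _ k, of "block nu j u"] by (simp add: block_def)
    show "(\<Sum>l = 0..<nu. stack_B N A B $$ (i * nx + k, j * nu + l) * u $ (j * nu + l))
      = (if j < i then ((A ^\<^sub>m (i - 1 - j) * B) *\<^sub>v block nu j u) $ k else 0)"
      unfolding r by (simp add: e cong: sum.cong_simp)
  qed
  also have "\<dots> = (\<Sum>j = 0..<i. ((A ^\<^sub>m (i - 1 - j) * B) *\<^sub>v block nu j u) $ k)"
    by (rule sum.mono_neutral_cong_right) (use i in auto)
  finally have b: "(stack_B N A B *\<^sub>v u) $ (i * nx + k)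
     = (\<Sum>j = 0..<i. ((A ^\<^sub>m (i - 1 - j) * B) *\<^sub>v block nu j u) $ k)" .
  show ?thesis using a b ik SB by (subst index_add_vec) auto
qed

lemma condensed_dynamics:
  assumes A: "A \<in> carrier_mat nx nx" and B: "B \<in> carrier_mat nx nu"
    and x0: "x0 \<in> carrier_vec nx" and u: "u \<in> carrier_vec (N * nu)" and i: "i \<le> N"
  shows "block nx i (stack_A N A *\<^sub>v x0 + stack_B N A B *\<^sub>v u) = trajectory A B x0 u i"
proof -
  define t where "t i = (\<lambda>k. (A ^\<^sub>m i *\<^sub>v x0) $ k
    + (\<Sum>j = 0..<i. ((A ^\<^sub>m (i - 1 - j) * B) *\<^sub>v block nu j u) $ k))" for i
  have P: "A ^\<^sub>m e \<in> carrier_mat nx nx" for e using A by simp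
  have bl: "block nu j u \<in> carrier_vec nu" for j by (simp add: block_def)
  have "trajectory A B x0 u i = vec nx (t i)"
  proof (induction i)
    case 0
    show ?case using A x0 by (intro eq_vecI) (auto simp: t_def)
  next
    case (Suc i)
    show ?case
    proof (rule eq_vecI)
      fix k assume "k < dim_vec (vec nx (t (Suc i)))"
      then have k: "k < nx" by simp
      have v: "vec nx (t i) \<in> carrier_vec nx" by simp
      have PB: "A ^\<^sub>m e * B \<in> carrier_mat nx nu" for e using P B by (rule mult_carrier_mat)
      have c: "(\<Sum>l = 0..<nx. A $$ (k, l) * (M *\<^sub>v w) $ l) = ((A * M) *\<^sub>v w) $ k"
        if M: "M \<in> carrier_mat nx m" and w: "w \<in> carrier_vec m" for M w m
        using mult_mat_vec_index[OF A _ k, of "M *\<^sub>v w"] assoc_mult_mat_vec[OF A M w] M w by auto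
      have "(A *\<^sub>v vec nx (t i)) $ k = (\<Sum>l = 0..<nx. A $$ (k, l) * t i l)"
        using mult_mat_vec_index[OF A v k] by simp
      also have "\<dots> = (\<Sum>l = 0..<nx. A $$ (k, l) * (A ^\<^sub>m i *\<^sub>v x0) $ l)
         + (\<Sum>j = 0..<i. \<Sum>l = 0..<nx. A $$ (k, l) * ((A ^\<^sub>m (i - 1 - j) * B) *\<^sub>v block nu j u) $ l)"
        by (subst sum.swap) (simp add: t_def distrib_left sum.distrib sum_distrib_left)
      also have "\<dots> = ((A * A ^\<^sub>m i) *\<^sub>v x0) $ k
         + (\<Sum>j = 0..<i. ((A * (A ^\<^sub>m (i - 1 - j) * B)) *\<^sub>v block nu j u) $ k)"
        unfolding c[OF P x0] c[OF PB bl] ..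
      also have "\<dots> = (A ^\<^sub>m Suc i *\<^sub>v x0) $ k
         + (\<Sum>j = 0..<i. ((A ^\<^sub>m (i - j) * B) *\<^sub>v block nu j u) $ k)"
      proof -
        have "A * (A ^\<^sub>m (i - 1 - j) * B) = A ^\<^sub>m (i - j) * B" if "j < i" for j
        proof -
          have "i - j = Suc (i - 1 - j)" using that by simp
          then show ?thesis
            using assoc_mult_mat[OF A P B] pow_mat_Suc_left[OF A] by metis
        qed
        then show ?thesis using pow_mat_Suc_left[OF A, of i] by simp
      qed
      finally have "(A *\<^sub>v vec nx (t i)) $ k = (A ^\<^sub>m Suc i *\<^sub>v x0) $ k
         + (\<Sum>j = 0..<i. ((A ^\<^sub>m (i - j) * B) *\<^sub>v block nu j u) $ k)" .
      moreover have "t (Suc i) k = (A ^\<^sub>m Suc i *\<^sub>v x0) $ k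
         + (\<Sum>j = 0..<i. ((A ^\<^sub>m (i - j) * B) *\<^sub>v block nu j u) $ k) + (B *\<^sub>v block nu i u) $ k"
        using A B by (simp add: t_def)
      ultimately show "trajectory A B x0 u (Suc i) $ k = vec nx (t (Suc i)) $ k"
        using Suc k A B by simp
    qed (use B in simp)
  qed
  moreover have "block nx i (stack_A N A *\<^sub>v x0 + stack_B N A B *\<^sub>v u) = vec nx (t i)"
    unfolding block_def[of nx] t_def
    by (rule eq_vecI) (simp_all add: stack_AB_index[OF A B x0 u i])
  ultimately show ?thesis by simp
qed

lemma condensed_constraints:
  assumes F: "F \<in> carrier_mat m nx" and G: "G \<in> carrier_mat m nu" and c: "c \<in> carrier_vec m"
    and H: "H \<in> carrier_mat q nx" and p: "p \<in> carrier_vec q"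
    and x: "x \<in> carrier_vec (Suc N * nx)" and u: "u \<in> carrier_vec (N * nu)"
  shows "stack_F N F H *\<^sub>v x + stack_G N G H *\<^sub>v u \<le> stack_c N c p \<longleftrightarrow>
    (\<forall>i<N. F *\<^sub>v block nx i x + G *\<^sub>v block nu i u \<le> c) \<and> H *\<^sub>v block nx N x \<le> p"
proof -
  define y where "y = vec (N * nx) (\<lambda>k. x $ k)"
  define z where "z = block nx N x"
  define KF where "KF = kronecker (1\<^sub>m N) F"
  define KG where "KG = kronecker (1\<^sub>m N) G"
  define cc where "cc = vec (N * m) (\<lambda>i. c $ (i mod m))"
  have KF: "KF \<in> carrier_mat (N * m) (N * nx)" using F by (auto simp: KF_def kronecker_def)
  have KG: "KG \<in> carrier_mat (N * m) (N * nu)" using G by (auto simp: KG_def kronecker_def)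
  have y: "y \<in> carrier_vec (N * nx)" and z: "z \<in> carrier_vec nx"
    by (auto simp: y_def z_def block_def)
  have xyz: "x = y @\<^sub>v z"
    using x by (intro eq_vecI) (auto simp: y_def z_def block_def)
  have d: "dim_row F = m" "dim_col F = nx" "dim_row G = m" "dim_col G = nu" "dim_row H = q"
    "dim_col H = nx" "dim_vec c = m" using F G H c by auto
  have 1: "stack_F N F H *\<^sub>v x = (KF *\<^sub>v y) @\<^sub>v (H *\<^sub>v z)"
  proof -
    have "stack_F N F H *\<^sub>v x = (KF *\<^sub>v y + 0\<^sub>m (N * m) nx *\<^sub>v z)
       @\<^sub>v (0\<^sub>m q (N * nx) *\<^sub>v y + H *\<^sub>v z)"
      unfolding stack_F_def d xyz KF_def[symmetric]
      by (rule four_block_mat_mult_vec[OF KF _ _ H y z]) auto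
    moreover have "KF *\<^sub>v y + 0\<^sub>m (N * m) nx *\<^sub>v z = KF *\<^sub>v y"
      "0\<^sub>m q (N * nx) *\<^sub>v y + H *\<^sub>v z = H *\<^sub>v z"
      using KF H y z by (auto intro!: eq_vecI)
    ultimately show ?thesis by simp
  qed
  have zu: "0\<^sub>m q (N * nu) *\<^sub>v u = 0\<^sub>v q" using u by (intro eq_vecI) auto
  have 2: "stack_G N G H *\<^sub>v u = (KG *\<^sub>v u) @\<^sub>v 0\<^sub>v q"
    unfolding stack_G_def d KG_def[symmetric]
    using mat_mult_append[OF KG zero_carrier_mat u, of q] zu by simp
  have 3: "stack_F N F H *\<^sub>v x + stack_G N G H *\<^sub>v u = (KF *\<^sub>v y + KG *\<^sub>v u) @\<^sub>v (H *\<^sub>v z)"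
    unfolding 1 2 using KF KG H y z u
    by (subst append_vec_add[of _ "N * m" _ _ q]) auto
  have 4: "KF *\<^sub>v y + KG *\<^sub>v u \<le> cc \<longleftrightarrow>
    (\<forall>i<N. F *\<^sub>v block nx i x + G *\<^sub>v block nu i u \<le> c)"
  proof -
    have by_eq: "block nx i y = block nx i x" if "i < N" for i
      unfolding block_def y_def
      by (rule eq_vecI) (use that in \<open>auto simp: block_index_less\<close>)
    have row: "(KF *\<^sub>v y + KG *\<^sub>v u) $ (i * m + k) = (F *\<^sub>v block nx i x + G *\<^sub>v block nu i u) $ k"
      "cc $ (i * m + k) = c $ k" if "i < N" "k < m" for i k
      using that block_index_less[of i N k m] KF KG F G
        kronecker_one_mult_vec[OF F y that] kronecker_one_mult_vec[OF G u that] by_eq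
      by (auto simp: KF_def KG_def cc_def)
    have split: "(\<forall>l<N * m. Q l) \<longleftrightarrow> (\<forall>i<N. \<forall>k<m. Q (i * m + k))" for Q
    proof (intro iffI allI impI)
      fix l assume *: "\<forall>i<N. \<forall>k<m. Q (i * m + k)" and l: "l < N * m"
      then have "0 < m" by (cases m) auto
      then have "l div m < N" "l mod m < m" using l by (auto simp: less_mult_imp_div_less)
      then have "Q ((l div m) * m + l mod m)" using * by blast
      then show "Q l" by simp
    qed (simp add: block_index_less)
    have dim: "dim_vec (KF *\<^sub>v y + KG *\<^sub>v u) = N * m" "dim_vec cc = N * m"
      "dim_vec (F *\<^sub>v block nx i x + G *\<^sub>v block nu i u) = m" "dim_vec c = m" for i
      using KG G c by (auto simp: cc_def)
    show ?thesis unfolding less_eq_vec_def dim split using row by simp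
  qed
  have cs: "stack_c N c p = cc @\<^sub>v p" by (simp add: stack_c_def cc_def d)
  have S: "KF *\<^sub>v y + KG *\<^sub>v u \<in> carrier_vec (N * m)" "cc \<in> carrier_vec (N * m)"
    using KG u KF y by (auto simp: cc_def intro!: add_carrier_vec mult_mat_vec_carrier)
  show ?thesis unfolding 3 cs append_vec_le[OF S] 4 by (simp add: z_def)
qed

text \<open>The affine hull of a nonempty \<open>P\<close> is parallel to the span of the differences of points of
  \<open>P\<close>, so the dimension of that span is the dimension of \<open>P\<close>.\<close>

definition (in vec_space) full_dimensional :: "'a vec set \<Rightarrow> bool" where
  "full_dimensional P \<longleftrightarrow> P \<noteq> {} \<and>
     vectorspace.dim class_ring (span_vs {r - r' | r r'. r \<in> P \<and> r' \<in> P}) = n"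

definition block_lower_triangular :: "nat \<Rightarrow> nat \<Rightarrow> real mat set" where
  "block_lower_triangular N nu = {M \<in> carrier_mat (N * nu) N.
     \<forall>i<N. \<forall>j<N. i < j \<longrightarrow> (\<forall>k<nu. M $$ (i * nu + k, j) = 0)}"

definition admissible_policies ::
  "nat \<Rightarrow> nat \<Rightarrow> real mat \<Rightarrow> real vec \<Rightarrow> real mat \<Rightarrow> real mat \<Rightarrow> real vec set \<Rightarrow> real vec \<Rightarrow>
     (real mat \<times> real vec) set" where
  "admissible_policies N nu \<Sigma> \<sigma> \<Xi> \<Gamma> P x0 =
     {(M, v). M \<in> block_lower_triangular N nu \<and> v \<in> carrier_vec (N * nu) \<and>
        (\<forall>r\<in>P. \<Sigma> *\<^sub>v (M *\<^sub>v r + v) \<le> \<sigma> + \<Xi> *\<^sub>v x0 \<and> \<Gamma> *\<^sub>v (M *\<^sub>v r + v) = r)}"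

end

theory Submission
  imports Defs "Jordan_Normal_Form.DL_Rank"
begin

text \<open>A row of \<open>\<Sigma> (M r + v) \<le> \<sigma> + \<Xi> x\<^sub>0\<close> holds on all of \<open>P\<close> iff an affine functional is bounded above
  on the nonempty polyhedron \<open>S r \<le> h\<close>, and by the affine Farkas lemma such a bound is certified by
  a nonnegative combination of the rows of \<open>(S, h)\<close>; these certificates are the columns of \<open>Z\<close>.
  The equality \<open>\<Gamma> (M r + v) = r\<close> says that the affine map \<open>(\<Gamma> M - I) r + \<Gamma> v\<close> vanishes on \<open>P\<close>, hence
  its linear part vanishes on the differences of points of \<open>P\<close>, which span the whole space.\<close>

section \<open>Farkas lemma: homogeneous, affine and matrix forms\<close>

text \<open>Bartl's induction on the number of functionals: if the last functional \<open>a m\<close> cannot be dropped,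
  there is \<open>y\<close> with \<open>a i \<bullet> y \<le> 0\<close> for \<open>i < m\<close>, \<open>c \<bullet> y > 0\<close> and \<open>a m \<bullet> y = 1\<close>; composing all
  functionals with the projection \<open>x \<mapsto> x - (a m \<bullet> x) y\<close> onto the kernel of \<open>a m\<close> reduces to \<open>m\<close> of them.\<close>

lemma farkas_homogeneous:
  fixes a :: "nat \<Rightarrow> real vec"
  assumes "\<And>i. i < m \<Longrightarrow> a i \<in> carrier_vec n" and "c \<in> carrier_vec n"
    and "\<And>x. x \<in> carrier_vec n \<Longrightarrow> (\<And>i. i < m \<Longrightarrow> a i \<bullet> x \<le> 0) \<Longrightarrow> c \<bullet> x \<le> 0"
  shows "\<exists>l. (\<forall>i<m. 0 \<le> l i) \<and> (\<forall>x\<in>carrier_vec n. c \<bullet> x = (\<Sum>i<m. l i * (a i \<bullet> x)))"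
  using assms
proof (induction m arbitrary: a c)
  case 0
  have "c \<bullet> x = 0" if x: "x \<in> carrier_vec n" for x
  proof -
    \<comment> \<open>With no constraints the hypothesis holds for both \<open>x\<close> and
      \<open>- x\<close>, which forces the value 0.\<close>
    have "c \<bullet> (- x) \<le> 0" by (rule "0.prems"(3)) (use x in auto)
    then show ?thesis using "0.prems"(3)[OF x] "0.prems"(2) x by simp
  qed
  then show ?case by simp
next
  case (Suc m)
  note a = Suc.prems(1) and c = Suc.prems(2)
  show ?case
  proof (cases "\<forall>x\<in>carrier_vec n. (\<forall>i<m. a i \<bullet> x \<le> 0) \<longrightarrow> c \<bullet> x \<le> 0")
    case True
    have "\<exists>l. (\<forall>i<m. 0 \<le> l i) \<and> (\<forall>x\<in>carrier_vec n. c \<bullet> x = (\<Sum>i<m. l i * (a i \<bullet> x)))"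
      by (rule Suc.IH) (use a c True in auto)
    then obtain l where l: "\<forall>i<m. 0 \<le> l i"
      "\<forall>x\<in>carrier_vec n. c \<bullet> x = (\<Sum>i<m. l i * (a i \<bullet> x))"
      by blast
    show ?thesis
      by (rule exI[of _ "l(m := 0)"]) (use l in \<open>auto simp: less_Suc_eq\<close>)
  next
    case False
    then obtain y where y: "y \<in> carrier_vec n" "\<forall>i<m. a i \<bullet> y \<le> 0" "c \<bullet> y > 0"
      by (auto simp: not_le)
    have am: "a m \<in> carrier_vec n" using a by simp
    \<comment> \<open>Otherwise \<open>y\<close> would satisfy all \<open>Suc m\<close>
      inequalities, contradicting \<open>c \<bullet> y > 0\<close>.\<close>
    have pos: "a m \<bullet> y > 0"
    proof (rule ccontr)
      assume "\<not> a m \<bullet> y > 0"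
      then have "c \<bullet> y \<le> 0" by (intro Suc.prems(3)) (use y in \<open>auto simp: less_Suc_eq\<close>)
      then show False using y by simp
    qed
    \<comment> \<open>Scaling by \<open>t\<close> replaces the normalisation: \<open>t * y\<close>
      plays the part of the vector on which \<open>a m\<close> takes the value 1.\<close>
    define t where "t = inverse (a m \<bullet> y)"
    have t: "t > 0" "t * (a m \<bullet> y) = 1" using pos by (auto simp: t_def)
    define a' where "a' i = a i - (t * (a i \<bullet> y)) \<cdot>\<^sub>v a m" for i
    define c' where "c' = c - (t * (c \<bullet> y)) \<cdot>\<^sub>v a m"
    have a'x: "a' i \<bullet> x = a i \<bullet> x - t * (a i \<bullet> y) * (a m \<bullet> x)"
      if "i < m" "x \<in> carrier_vec n" for i x
      using that a am unfolding a'_def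
      by (subst minus_scalar_prod_distrib[of _ n]) auto
    have c'x: "c' \<bullet> x = c \<bullet> x - t * (c \<bullet> y) * (a m \<bullet> x)" if "x \<in> carrier_vec n" for x
      using that c am unfolding c'_def
      by (subst minus_scalar_prod_distrib[of _ n]) auto
    have "c' \<bullet> x \<le> 0" if x: "x \<in> carrier_vec n" and le: "\<And>i. i < m \<Longrightarrow> a' i \<bullet> x \<le> 0" for x
    proof -
      \<comment> \<open>The projection of \<open>x\<close> along \<open>y\<close> onto the kernel of
        \<open>a m\<close>. Primed functionals at \<open>x\<close> equal unprimed ones at
        \<open>x'\<close>, and \<open>a m\<close> is 0 there, so the original hypothesis applies to
        \<open>x'\<close>.\<close>
      define x' where "x' = x - (t * (a m \<bullet> x)) \<cdot>\<^sub>v y"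
      have x': "x' \<in> carrier_vec n" using x y by (simp add: x'_def)
      have d: "b \<bullet> x' = b \<bullet> x - t * (a m \<bullet> x) * (b \<bullet> y)" if "b \<in> carrier_vec n" for b
        using that x y unfolding x'_def
        by (subst scalar_prod_minus_distrib[of _ n]) auto
      have "a i \<bullet> x' \<le> 0" if i: "i < Suc m" for i
      proof (cases "i = m")
        case True
        have "t * (a m \<bullet> x) * (a m \<bullet> y) = (a m \<bullet> x) * (t * (a m \<bullet> y))"
          by (simp only: ac_simps)
        also have "\<dots> = a m \<bullet> x" using t(2) by simp
        finally show ?thesis unfolding True d[OF am] by linarith
      next
        case False
        then show ?thesis using d[OF a[OF i]] a'x[OF _ x, of i] le[of i] i
          by (simp add: algebra_simps)
      qed
      then have "c \<bullet> x' \<le> 0" by (rule Suc.prems(3)[OF x'])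
      then show ?thesis using d[OF c] c'x[OF x] by (simp add: algebra_simps)
    qed
    moreover have "a' i \<in> carrier_vec n" if "i < m" for i using that a am by (simp add: a'_def)
    moreover have "c' \<in> carrier_vec n" using c am by (simp add: c'_def)
    ultimately have "\<exists>l. (\<forall>i<m. 0 \<le> l i) \<and> (\<forall>x\<in>carrier_vec n. c' \<bullet> x = (\<Sum>i<m. l i * (a' i \<bullet> x)))"
      by (intro Suc.IH) auto
    then obtain l where l: "\<forall>i<m. 0 \<le> l i"
      "\<forall>x\<in>carrier_vec n. c' \<bullet> x = (\<Sum>i<m. l i * (a' i \<bullet> x))"
      by blast
    \<comment> \<open>Collecting the multiples of \<open>a m\<close> after expanding
      \<open>c'\<close> and all \<open>a' i\<close> leaves this coefficient. It is nonnegative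
      because \<open>c\<close> is positive at \<open>y\<close> and each \<open>a i\<close> with
      \<open>i < m\<close> is nonpositive there.\<close>
    define s where "s = t * (c \<bullet> y) - (\<Sum>i<m. l i * (t * (a i \<bullet> y)))"
    have "(\<Sum>i<m. l i * (t * (a i \<bullet> y))) \<le> 0"
      by (rule sum_nonpos) (use l(1) y t in \<open>auto simp: mult_nonneg_nonpos\<close>)
    moreover have "0 \<le> t * (c \<bullet> y)" using t y by simp
    ultimately have s: "0 \<le> s" by (simp add: s_def)
    have "c \<bullet> x = (\<Sum>i<Suc m. (l(m := s)) i * (a i \<bullet> x))" if x: "x \<in> carrier_vec n" for x
    proof -
      have "c \<bullet> x = (\<Sum>i<m. l i * (a i \<bullet> x - t * (a i \<bullet> y) * (a m \<bullet> x)))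
          + t * (c \<bullet> y) * (a m \<bullet> x)"
        using c'x[OF x] l(2) x a'x[OF _ x] by simp
      also have "\<dots> = (\<Sum>i<m. l i * (a i \<bullet> x)) + s * (a m \<bullet> x)"
        by (simp add: s_def sum_subtractf right_diff_distrib left_diff_distrib sum_distrib_right
            mult.assoc)
      finally show ?thesis by simp
    qed
    then show ?thesis
      by (intro exI[of _ "l(m := s)"]) (use l(1) s in \<open>auto simp: less_Suc_eq\<close>)
  qed
qed

text \<open>Homogenise with an extra leading coordinate \<open>t \<ge> 0\<close>: the rows become \<open>S r - t h \<le> 0\<close>.  At
  \<open>t = 0\<close>, \<open>r\<close> is a recession direction, along which the functional cannot increase.\<close>

lemma farkas_affine:
  fixes S :: "real mat"
  assumes S: "S \<in> carrier_mat k n" and h: "h \<in> carrier_vec k" and c: "c \<in> carrier_vec n"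
    and y: "y \<in> carrier_vec n" "S *\<^sub>v y \<le> h"
    and bound: "\<And>r. r \<in> carrier_vec n \<Longrightarrow> S *\<^sub>v r \<le> h \<Longrightarrow> c \<bullet> r \<le> b"
  shows "\<exists>l. (\<forall>i<k. 0 \<le> l i) \<and> (\<forall>j<n. (\<Sum>i<k. l i * S $$ (i, j)) = c $ j)
    \<and> (\<Sum>i<k. l i * h $ i) \<le> b"
proof -
  \<comment> \<open>Index \<open>k\<close> carries the extra row, for which
    \<open>a k \<bullet> x \<le> 0\<close> says \<open>t \<ge> 0\<close>.\<close>
  define a where "a i = (if i < k then vCons (- h $ i) (row S i) else vCons (-1) (0\<^sub>v n))" for i
  have rS: "row S i \<in> carrier_vec n" if "i < k" for i using that S by simp
  have le_iff: "S *\<^sub>v r \<le> h \<longleftrightarrow> (\<forall>i<k. row S i \<bullet> r \<le> h $ i)" for r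
    using S h by (auto simp: less_eq_vec_def)
  have "vCons (- b) c \<bullet> x \<le> 0"
    if x: "x \<in> carrier_vec (Suc n)" and ax: "\<And>i. i < Suc k \<Longrightarrow> a i \<bullet> x \<le> 0" for x
  proof -
    obtain t r where xr: "x = vCons t r" using x by (cases x) auto
    then have r: "r \<in> carrier_vec n" using x by simp
    have rows: "row S i \<bullet> r \<le> t * h $ i" if "i < k" for i
      using ax[of i] that by (simp add: a_def xr mult.commute)
    have "t \<ge> 0" using ax[of k] r by (simp add: a_def xr)
    then consider "t > 0" | "t = 0" by linarith
    then have "c \<bullet> r \<le> t * b"
    proof cases
      case 1
      \<comment> \<open>For \<open>t > 0\<close>, dehomogenising gives the point
        \<open>r / t\<close> of the polyhedron, where \<open>bound\<close> applies.\<close>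
      have "S *\<^sub>v (inverse t \<cdot>\<^sub>v r) \<le> h"
        unfolding le_iff
      proof (intro allI impI)
        fix i assume i: "i < k"
        have "row S i \<bullet> (inverse t \<cdot>\<^sub>v r) = inverse t * (row S i \<bullet> r)"
          using scalar_prod_smult_distrib[OF rS[OF i] r] .
        also have "\<dots> \<le> h $ i" using rows[OF i] 1 by (simp add: field_simps)
        finally show "row S i \<bullet> (inverse t \<cdot>\<^sub>v r) \<le> h $ i" .
      qed
      then have "c \<bullet> (inverse t \<cdot>\<^sub>v r) \<le> b" using bound r by simp
      then have "inverse t * (c \<bullet> r) \<le> b" using scalar_prod_smult_distrib[OF c r] by simp
      then show ?thesis using 1 by (simp add: field_simps)
    next
      case 2
      have "c \<bullet> r \<le> 0"
      proof (rule ccontr)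
        assume "\<not> c \<bullet> r \<le> 0"
        then have pos: "c \<bullet> r > 0" by simp
        \<comment> \<open>A step this long from \<open>y\<close> along \<open>r\<close> stays
          feasible but raises the functional to at least \<open>b + 1\<close>.\<close>
        define s where "s = (\<bar>b - c \<bullet> y\<bar> + 1) / (c \<bullet> r)"
        have s: "s \<ge> 0" "s * (c \<bullet> r) = \<bar>b - c \<bullet> y\<bar> + 1" using pos by (auto simp: s_def)
        have "row S i \<bullet> (y + s \<cdot>\<^sub>v r) \<le> h $ i" if "i < k" for i
        proof -
          have "row S i \<bullet> (y + s \<cdot>\<^sub>v r) = row S i \<bullet> y + s * (row S i \<bullet> r)"
            using rS[OF that] y r by (subst scalar_prod_add_distrib[of _ n]) auto
          moreover have "s * (row S i \<bullet> r) \<le> 0"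
            using rows[OF that] 2 s by (simp add: mult_nonneg_nonpos)
          moreover have "row S i \<bullet> y \<le> h $ i" using y(2) that unfolding le_iff by simp
          ultimately show ?thesis by linarith
        qed
        then have "c \<bullet> (y + s \<cdot>\<^sub>v r) \<le> b" by (intro bound) (use y r le_iff in auto)
        moreover have "c \<bullet> (y + s \<cdot>\<^sub>v r) = c \<bullet> y + s * (c \<bullet> r)"
          using c y r by (subst scalar_prod_add_distrib[of _ n]) auto
        ultimately show False using s by linarith
      qed
      then show ?thesis using 2 by simp
    qed
    then show ?thesis by (simp add: xr mult.commute)
  qed
  moreover have "a i \<in> carrier_vec (Suc n)" for i using rS by (simp add: a_def)
  moreover have "vCons (- b) c \<in> carrier_vec (Suc n)" using c by simp
  ultimately have "\<exists>l. (\<forall>i<Suc k. 0 \<le> l i) \<and>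
      (\<forall>x\<in>carrier_vec (Suc n). vCons (- b) c \<bullet> x = (\<Sum>i<Suc k. l i * (a i \<bullet> x)))"
    by (intro farkas_homogeneous) auto
  then obtain l where l: "\<forall>i<Suc k. 0 \<le> l i"
    "\<forall>x\<in>carrier_vec (Suc n). vCons (- b) c \<bullet> x = (\<Sum>i<Suc k. l i * (a i \<bullet> x))"
    by blast
  have comb: "- b * t + c \<bullet> r = (\<Sum>i<k. l i * (- h $ i * t + row S i \<bullet> r)) - l k * t"
    if r: "r \<in> carrier_vec n" for t r
    using bspec[OF l(2), of "vCons t r"] r by (simp add: a_def)
  have "(\<Sum>i<k. l i * S $$ (i, j)) = c $ j" if j: "j < n" for j
    \<comment> \<open>The points \<open>(0, unit_vec n j)\<close> read off the linear part;
      \<open>(1, 0)\<close> below reads off the constant part, with \<open>l k\<close> as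
      slack.\<close>
    using comb[of "unit_vec n j" 0] j S c by simp
  moreover have "(\<Sum>i<k. l i * h $ i) \<le> b"
  proof -
    have "- b = (\<Sum>i<k. l i * (- h $ i)) - l k"
      using comb[of "0\<^sub>v n" 1] c rS by (simp cong: sum.cong_simp)
    moreover have "0 \<le> l k" using l(1) by simp
    ultimately show ?thesis by (simp add: sum_negf)
  qed
  ultimately show ?thesis using l(1) by (intro exI[of _ l]) auto
qed

text \<open>Each row of \<open>Q\<close> has its own Farkas certificate, stored as a column of
  \<open>Z\<close>; conversely, a nonnegative \<open>Z\<^sup>T\<close> preserves
  \<open>S r \<le> h\<close>. The point \<open>y\<close> excludes the empty polyhedron, where the
  left side is vacuous but a certificate may fail to exist.\<close>

lemma polyhedron_mult_le_iff:
  fixes S Q :: "real mat"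
  assumes S: "S \<in> carrier_mat k n" and h: "h \<in> carrier_vec k"
    and Q: "Q \<in> carrier_mat a n" and d: "d \<in> carrier_vec a"
    and y: "y \<in> carrier_vec n" "S *\<^sub>v y \<le> h"
  shows "(\<forall>r\<in>carrier_vec n. S *\<^sub>v r \<le> h \<longrightarrow> Q *\<^sub>v r \<le> d) \<longleftrightarrow>
    (\<exists>Z\<in>carrier_mat k a. 0\<^sub>m k a \<le> Z \<and> Z\<^sup>T *\<^sub>v h \<le> d \<and> Z\<^sup>T * S = Q)"
    (is "?L \<longleftrightarrow> ?R")
proof
  assume L: ?L
  have "\<exists>l. (\<forall>i<k. 0 \<le> l i) \<and> (\<forall>j<n. (\<Sum>i<k. l i * S $$ (i, j)) = row Q e $ j)
    \<and> (\<Sum>i<k. l i * h $ i) \<le> d $ e" if e: "e < a" for e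
  proof (rule farkas_affine[OF S h _ y])
    show "row Q e \<bullet> r \<le> d $ e" if "r \<in> carrier_vec n" "S *\<^sub>v r \<le> h" for r
      using L that e Q d by (auto simp: less_eq_vec_def)
  qed (use e Q in simp)
  then have "\<forall>e\<in>{..<a}. \<exists>l. (\<forall>i<k. 0 \<le> l i)
      \<and> (\<forall>j<n. (\<Sum>i<k. l i * S $$ (i, j)) = row Q e $ j) \<and> (\<Sum>i<k. l i * h $ i) \<le> d $ e"
    by simp
  from bchoice[OF this] obtain l where "\<forall>e\<in>{..<a}. (\<forall>i<k. 0 \<le> l e i)
      \<and> (\<forall>j<n. (\<Sum>i<k. l e i * S $$ (i, j)) = row Q e $ j) \<and> (\<Sum>i<k. l e i * h $ i) \<le> d $ e"
    by blast
  then have l: "\<And>e i. e < a \<Longrightarrow> i < k \<Longrightarrow> 0 \<le> l e i"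
    "\<And>e j. e < a \<Longrightarrow> j < n \<Longrightarrow> (\<Sum>i<k. l e i * S $$ (i, j)) = row Q e $ j"
    "\<And>e. e < a \<Longrightarrow> (\<Sum>i<k. l e i * h $ i) \<le> d $ e"
    by simp_all
  define Z where "Z = mat k a (\<lambda>(i, e). l e i)"
  have "0\<^sub>m k a \<le> Z" using l(1) by (auto simp: less_eq_mat_def Z_def)
  moreover have "Z\<^sup>T *\<^sub>v h \<le> d"
    using l(3) h d by (auto simp: less_eq_vec_def Z_def scalar_prod_def lessThan_atLeast0)
  moreover have "Z\<^sup>T * S = Q"
  proof (rule eq_matI)
    fix e j assume "e < dim_row Q" "j < dim_col Q"
    then show "(Z\<^sup>T * S) $$ (e, j) = Q $$ (e, j)"
      using l(2)[of e j] S Q by (auto simp: Z_def scalar_prod_def lessThan_atLeast0)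
  qed (use S Q in \<open>auto simp: Z_def\<close>)
  ultimately show ?R by (intro bexI[of _ Z]) (auto simp: Z_def)
next
  assume ?R
  then obtain Z where Z: "Z \<in> carrier_mat k a" "0\<^sub>m k a \<le> Z" "Z\<^sup>T *\<^sub>v h \<le> d" "Z\<^sup>T * S = Q" by blast
  show ?L
  proof (intro ballI impI)
    fix r assume r: "r \<in> carrier_vec n" "S *\<^sub>v r \<le> h"
    have "Q *\<^sub>v r = Z\<^sup>T *\<^sub>v (S *\<^sub>v r)" using Z(1,4) S r by auto
    also have "\<dots> \<le> Z\<^sup>T *\<^sub>v h"
      using Z(1,2) S h r(2)
      by (auto simp: less_eq_vec_def less_eq_mat_def scalar_prod_def intro!: sum_mono mult_left_mono)
    also note Z(3)
    finally show "Q *\<^sub>v r \<le> d" .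
  qed
qed

section \<open>Full-dimensional sets and affine maps that fix them\<close>

context vec_space
begin

text \<open>Independent subsets of \<open>D\<close> have at most \<open>n\<close> elements, so a
  maximal one \<open>U\<close> exists even for infinite \<open>D\<close>. By maximality
  \<open>U\<close> spans \<open>D\<close>, so it has \<open>n\<close> elements and is a
  basis.\<close>

lemma dim_span_eq_imp_span_eq_carrier:
  assumes D: "D \<subseteq> carrier_vec n" and dim_D: "vectorspace.dim class_ring (span_vs D) = n"
  shows "span D = carrier_vec n"
proof -
  have "finite A \<and> card A \<le> n" if "A \<subseteq> D \<and> lin_indpt A" for A
    using that D li_le_dim[of A] dim_is_n by auto
  moreover have "{} \<subseteq> D \<and> lin_indpt {}" by (auto simp: lin_dep_def)
  ultimately obtain U where U: "finite U" "maximal U (\<lambda>T. T \<subseteq> D \<and> lin_indpt T)"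
    using maximal_exists[of "\<lambda>T. T \<subseteq> D \<and> lin_indpt T" n "{}"] by blast
  then have UD: "U \<subseteq> D" and li: "lin_indpt U" by (auto simp: maximal_def)
  have Uc: "U \<subseteq> carrier_vec n" using UD D by auto
  have "D \<subseteq> span U"
  proof
    fix s assume s: "s \<in> D"
    show "s \<in> span U"
    proof (rule ccontr)
      assume ns: "s \<notin> span U"
      then have "s \<notin> U" using in_own_span[OF Uc] by auto
      moreover have "lin_indpt (insert s U)"
        using lin_dep_iff_in_span[OF Uc li, of s] s D ns \<open>s \<notin> U\<close> by auto
      ultimately show False using U(2) s UD by (auto simp: maximal_def)
    qed
  qed
  then have eq: "span D = span U"
    using span_subsetI[of U D] span_is_monotone[OF UD] Uc by auto
  \<comment> \<open>\<open>dim_span\<close> requires a finite generating set; \<open>U\<close>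
    serves as its own.\<close>
  have "maximal U (\<lambda>T. T \<subseteq> U \<and> lin_indpt T)" using li by (auto simp: maximal_def)
  from dim_span[OF Uc U(1) this] have "card U = n" using dim_D eq by simp
  then have "basis U" using dim_li_is_basis[OF fin_dim U(1) Uc li] dim_is_n by simp
  then show ?thesis using eq by (simp add: basis_def)
qed

lemma mult_mat_vec_span_zero:
  assumes K: "K \<in> carrier_mat a n" and D: "D \<subseteq> carrier_vec n"
    and zero: "\<And>w. w \<in> D \<Longrightarrow> K *\<^sub>v w = 0\<^sub>v a" and v: "v \<in> span D"
  shows "K *\<^sub>v v = 0\<^sub>v a"
proof -
  obtain f A where A: "v = lincomb f A" "finite A" "A \<subseteq> D" using in_spanE[OF v] by blast
  have "K *\<^sub>v lincomb f A = 0\<^sub>v a" using A(2,3)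
  proof (induction A)
    case empty
    then show ?case using K by (intro eq_vecI) (auto simp: lincomb_def)
  next
    case (insert w A)
    have w: "w \<in> carrier_vec n" and Ac: "A \<subseteq> carrier_vec n" using insert.prems D by auto
    have l: "lincomb f A \<in> carrier_vec n" using lincomb_closed[OF Ac, of f] by simp
    have "lincomb f (insert w A) = f w \<cdot>\<^sub>v w + lincomb f A"
      using lincomb_insert2[OF insert.hyps(1) Ac _ insert.hyps(2), of f] w by simp
    then show ?case using insert K w l zero[of w]
      by (simp add: mult_add_distrib_mat_vec[OF K] mult_mat_vec[OF K]) (auto intro!: eq_vecI)
  qed
  then show ?thesis using A by simp
qed

text \<open>Used with \<open>T = \<Gamma> * M\<close> and \<open>w = \<Gamma> v\<close>. The matrix
  \<open>T - I\<close> sends every point of \<open>P\<close> to \<open>- w\<close>, hence kills the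
  spanning differences; being zero, it gives \<open>w = 0\<close> at any point of
  \<open>P\<close>.\<close>

lemma full_dimensional_affine_fixed:
  assumes P: "P \<subseteq> carrier_vec n" "full_dimensional P"
    and T: "T \<in> carrier_mat n n" and w: "w \<in> carrier_vec n"
    and fixed: "\<And>r. r \<in> P \<Longrightarrow> T *\<^sub>v r + w = r"
  shows "T = 1\<^sub>m n" and "w = 0\<^sub>v n"
proof -
  define D where "D = {r - r' | r r'. r \<in> P \<and> r' \<in> P}"
  define K where "K = T - 1\<^sub>m n"
  have K: "K \<in> carrier_mat n n" unfolding K_def by (rule minus_carrier_mat) simp
  have Kv: "K *\<^sub>v v = T *\<^sub>v v - v" if "v \<in> carrier_vec n" for v
    using minus_mult_distrib_mat_vec[OF T one_carrier_mat that] that by (simp add: K_def)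
  have D: "D \<subseteq> carrier_vec n" using P(1) by (auto simp: D_def intro!: minus_carrier_vec)
  have span: "span D = carrier_vec n"
    using P(2) dim_span_eq_imp_span_eq_carrier[OF D] unfolding full_dimensional_def D_def by simp
  have KP: "K *\<^sub>v r = - w" if "r \<in> P" for r
  proof -
    have r: "r \<in> carrier_vec n" using that P by auto
    show ?thesis unfolding Kv[OF r]
    proof (rule eq_vecI)
      fix i assume "i < dim_vec (- w)"
      then show "(T *\<^sub>v r - r) $ i = (- w) $ i"
        using arg_cong[OF fixed[OF that], of "\<lambda>u. u $ i"] T r w
        by (simp add: algebra_simps eq_neg_iff_add_eq_0)
    qed (use r w in auto)
  qed
  have "K *\<^sub>v z = 0\<^sub>v n" if zD: "z \<in> D" for z
  proof -
    obtain r r' where z: "z = r - r'" "r \<in> P" "r' \<in> P" using zD by (auto simp: D_def)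
    then have "r \<in> carrier_vec n" "r' \<in> carrier_vec n" using P by auto
    then show ?thesis using z KP w by (simp add: mult_minus_distrib_mat_vec[OF K])
  qed
  then have K0: "K *\<^sub>v v = 0\<^sub>v n" if "v \<in> carrier_vec n" for v
    using mult_mat_vec_span_zero[OF K D _ , of v] span that by blast
  have Tv: "T *\<^sub>v v = v" if "v \<in> carrier_vec n" for v
  proof (rule eq_vecI)
    fix i assume "i < dim_vec v"
    then show "(T *\<^sub>v v) $ i = v $ i"
      using arg_cong[OF K0[OF that], of "\<lambda>u. u $ i"] Kv[OF that] T that by simp
  qed (use T that in simp)
  show "T = 1\<^sub>m n"
  proof (rule eq_matI)
    fix i j assume "i < dim_row (1\<^sub>m n)" "j < dim_col (1\<^sub>m n)"
    then show "T $$ (i, j) = 1\<^sub>m n $$ (i, j)"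
      using arg_cong[OF Tv[of "unit_vec n j"], of "\<lambda>u. u $ i"] T by auto
  qed (use T in auto)
  obtain r where r: "r \<in> P" using P(2) by (auto simp: full_dimensional_def)
  then have "- w = 0\<^sub>v n" using KP K0 P by (metis subsetD)
  then show "w = 0\<^sub>v n" using w by (metis uminus_zero_vec uminus_uminus_vec)
qed

end

section \<open>Characterisation of the admissible policies\<close>

theorem lemma2:
  fixes A B F G H S \<Sigma> \<Xi> \<Gamma> :: "real mat"
    and c p g h x0 \<sigma> :: "real vec"
    and P :: "real vec set"
    and N nx nu m q nc nh :: nat
  assumes "A \<in> carrier_mat nx nx" and "B \<in> carrier_mat nx nu"
    and "F \<in> carrier_mat m nx" and "G \<in> carrier_mat m nu" and "c \<in> carrier_vec m"
    and "H \<in> carrier_mat q nx" and "p \<in> carrier_vec q"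
    and "g \<in> carrier_vec nu"
    and "nc = dim_row (stack_F N F H)"
    and "\<Sigma> = stack_F N F H * stack_B N A B + stack_G N G H"
    and "\<sigma> = stack_c N c p"
    and "\<Xi> = - (stack_F N F H * stack_A N A)"
    and "\<Gamma> = kronecker (1\<^sub>m N) (mat_of_row g)"
    and "S \<in> carrier_mat nh N" and "h \<in> carrier_vec nh"
    and "P = {r \<in> carrier_vec N. S *\<^sub>v r \<le> h}"
    and "vec_space.full_dimensional N P"
    and "x0 \<in> carrier_vec nx"
  shows "admissible_policies N nu \<Sigma> \<sigma> \<Xi> \<Gamma> P x0 =
    {(M, v). M \<in> carrier_mat (N * nu) N \<and> v \<in> carrier_vec (N * nu) \<and>
       (\<exists>Z \<in> carrier_mat nh nc. 0\<^sub>m nh nc \<le> Z \<and>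
          \<Sigma> *\<^sub>v v + Z\<^sup>T *\<^sub>v h \<le> \<sigma> + \<Xi> *\<^sub>v x0 \<and>
          Z\<^sup>T * S = \<Sigma> * M \<and>
          \<Gamma> * M = 1\<^sub>m N \<and> \<Gamma> *\<^sub>v v = 0\<^sub>v N \<and>
          M \<in> block_lower_triangular N nu)}"
proof -
  have nc: "nc = N * m + q"
    using assms(1-9) by (simp add: stack_F_def kronecker_def)
  have SF: "stack_F N F H \<in> carrier_mat nc (Suc N * nx)"
    using assms(1-9) unfolding stack_F_def nc
    by (auto simp: kronecker_def)
  have SB: "stack_B N A B \<in> carrier_mat (Suc N * nx) (N * nu)"
    using assms(1,2) by (auto simp: stack_B_def Let_def)
  have SA: "stack_A N A \<in> carrier_mat (Suc N * nx) nx"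
    using assms(1) by (auto simp: stack_A_def Let_def)
  have SG: "stack_G N G H \<in> carrier_mat nc (N * nu)"
    using assms(1-9) unfolding stack_G_def nc
    by (intro carrier_append_rows) (auto simp: kronecker_def)
  have \<Sigma>: "\<Sigma> \<in> carrier_mat nc (N * nu)" unfolding assms(10) using SF SB SG by auto
  have \<sigma>: "\<sigma> \<in> carrier_vec nc" unfolding assms(11) nc stack_c_def using assms(5,7) by auto
  have \<Xi>: "\<Xi> \<in> carrier_mat nc nx" unfolding assms(12) using SF SA by auto
  have \<Gamma>: "\<Gamma> \<in> carrier_mat N (N * nu)" unfolding assms(13) using assms(8) by (auto simp: kronecker_def)
  note S = assms(14) and h = assms(15) and P = assms(16) and full = assms(17) and x0 = assms(18)
  \<comment> \<open>Full dimension includes nonemptiness, which supplies the feasible point for the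
    Farkas lemma.\<close>
  obtain y where y: "y \<in> carrier_vec N" "S *\<^sub>v y \<le> h"
    using full unfolding vec_space.full_dimensional_def P by blast
  have dyn: "(\<forall>r\<in>P. \<Sigma> *\<^sub>v (M *\<^sub>v r + v) \<le> \<sigma> + \<Xi> *\<^sub>v x0) \<longleftrightarrow>
      (\<exists>Z\<in>carrier_mat nh nc. 0\<^sub>m nh nc \<le> Z \<and> \<Sigma> *\<^sub>v v + Z\<^sup>T *\<^sub>v h \<le> \<sigma> + \<Xi> *\<^sub>v x0 \<and> Z\<^sup>T * S = \<Sigma> * M)"
    if M: "M \<in> carrier_mat (N * nu) N" and v: "v \<in> carrier_vec (N * nu)" for M v
  proof -
    \<comment> \<open>Moving the constant term \<open>\<Sigma> v\<close> to the right turns the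
      robust constraint into \<open>(\<Sigma> * M) r \<le> d\<close> on the polyhedron.\<close>
    define d where "d = \<sigma> + \<Xi> *\<^sub>v x0 - \<Sigma> *\<^sub>v v"
    have d: "d \<in> carrier_vec nc" using \<sigma> \<Xi> \<Sigma> x0 v by (simp add: d_def)
    have Q: "\<Sigma> * M \<in> carrier_mat nc N" using \<Sigma> M by simp
    have shift: "u \<le> d \<longleftrightarrow> \<Sigma> *\<^sub>v v + u \<le> \<sigma> + \<Xi> *\<^sub>v x0" if "u \<in> carrier_vec nc" for u
      using that \<sigma> \<Xi> \<Sigma> x0 v by (auto simp: less_eq_vec_def d_def algebra_simps)
    have exp: "\<Sigma> *\<^sub>v (M *\<^sub>v r + v) = \<Sigma> *\<^sub>v v + (\<Sigma> * M) *\<^sub>v r" if r: "r \<in> carrier_vec N" for r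
    proof -
      have "\<Sigma> *\<^sub>v (M *\<^sub>v r + v) = (\<Sigma> * M) *\<^sub>v r + \<Sigma> *\<^sub>v v"
        using mult_add_distrib_mat_vec[OF \<Sigma> mult_mat_vec_carrier[OF M r] v]
          assoc_mult_mat_vec[OF \<Sigma> M r] by simp
      also have "\<dots> = \<Sigma> *\<^sub>v v + (\<Sigma> * M) *\<^sub>v r"
        by (rule comm_add_vec[of _ nc]) (use Q \<Sigma> v r in auto)
      finally show ?thesis .
    qed
    have "(\<forall>r\<in>P. \<Sigma> *\<^sub>v (M *\<^sub>v r + v) \<le> \<sigma> + \<Xi> *\<^sub>v x0) \<longleftrightarrow>
        (\<forall>r\<in>carrier_vec N. S *\<^sub>v r \<le> h \<longrightarrow> (\<Sigma> * M) *\<^sub>v r \<le> d)"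
      using exp shift mult_mat_vec_carrier[OF Q] by (auto simp: P)
    also have "\<dots> \<longleftrightarrow> (\<exists>Z\<in>carrier_mat nh nc. 0\<^sub>m nh nc \<le> Z \<and> Z\<^sup>T *\<^sub>v h \<le> d \<and> Z\<^sup>T * S = \<Sigma> * M)"
      by (rule polyhedron_mult_le_iff[OF S h Q d y])
    also have "\<dots> \<longleftrightarrow> (\<exists>Z\<in>carrier_mat nh nc. 0\<^sub>m nh nc \<le> Z \<and>
        \<Sigma> *\<^sub>v v + Z\<^sup>T *\<^sub>v h \<le> \<sigma> + \<Xi> *\<^sub>v x0 \<and> Z\<^sup>T * S = \<Sigma> * M)"
      by (intro bex_cong refl) (use shift h in auto)
    finally show ?thesis .
  qed
  have track: "(\<forall>r\<in>P. \<Gamma> *\<^sub>v (M *\<^sub>v r + v) = r) \<longleftrightarrow> \<Gamma> * M = 1\<^sub>m N \<and> \<Gamma> *\<^sub>v v = 0\<^sub>v N"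
    if M: "M \<in> carrier_mat (N * nu) N" and v: "v \<in> carrier_vec (N * nu)" for M v
  proof -
    have Pc: "P \<subseteq> carrier_vec N" using P by auto
    have T: "\<Gamma> * M \<in> carrier_mat N N" and w: "\<Gamma> *\<^sub>v v \<in> carrier_vec N" using \<Gamma> M v by auto
    have exp: "\<Gamma> *\<^sub>v (M *\<^sub>v r + v) = (\<Gamma> * M) *\<^sub>v r + \<Gamma> *\<^sub>v v" if "r \<in> P" for r
      using mult_add_distrib_mat_vec[OF \<Gamma> mult_mat_vec_carrier[OF M] v, of r]
        assoc_mult_mat_vec[OF \<Gamma> M, of r] that Pc by auto
    show ?thesis
    proof
      assume "\<forall>r\<in>P. \<Gamma> *\<^sub>v (M *\<^sub>v r + v) = r"
      then have "\<And>r. r \<in> P \<Longrightarrow> (\<Gamma> * M) *\<^sub>v r + \<Gamma> *\<^sub>v v = r" using exp by simp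
      from vec_space.full_dimensional_affine_fixed[OF Pc full T w this]
      show "\<Gamma> * M = 1\<^sub>m N \<and> \<Gamma> *\<^sub>v v = 0\<^sub>v N" by simp
    next
      assume "\<Gamma> * M = 1\<^sub>m N \<and> \<Gamma> *\<^sub>v v = 0\<^sub>v N"
      then show "\<forall>r\<in>P. \<Gamma> *\<^sub>v (M *\<^sub>v r + v) = r" using exp Pc by auto
    qed
  qed
  have LT: "M \<in> carrier_mat (N * nu) N" if "M \<in> block_lower_triangular N nu" for M
    using that by (simp add: block_lower_triangular_def)
  show ?thesis
    \<comment> \<open>Membership in \<open>block_lower_triangular\<close> occurs on both sides and
      gives the dimensions of \<open>M\<close> that \<open>dyn\<close> and \<open>track\<close>
      require; the universal condition over \<open>P\<close> splits into these two.\<close>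
    unfolding admissible_policies_def ball_conj_distrib using LT dyn track by blast
qed

end
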